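(* The principal 3D slice $\mathcal{T}(\mathbf{i_1},\mathbf{i_2},\mathbf{j_2})$ of the tricomplex Mandelbrot set (the Turtlebrot) satisfies $$\mathcal{T}(\mathbf{i_1},\mathbf{i_2},\mathbf{j_2}) = \mathcal{T}^{\ast}(\mathbf{i_1},\mathbf{i_2},-\mathbf{j_1})\cap\mathcal{T}^{\ast}(\mathbf{i_1},\mathbf{i_2},\mathbf{j_1}),$$ where $$\mathcal{T}^{\ast}(\mathbf{i_1},\mathbf{i_2},\mathbf{j_1}) := \{c_2\mathbf{i_1}+c_3\mathbf{i_2}+c_6\mathbf{j_2}: c_2,c_3,c_6\in\mathbb{R},\ c_2\mathbf{i_1}+c_3\mathbf{i_2}+c_6\mathbf{j_1} \in \mathcal{T}(\mathbf{i_1},\mathbf{i_2},\mathbf{j_1})\}$$ and $$\mathcal{T}^{\ast}(\mathbf{i_1},\mathbf{i_2},-\mathbf{j_1}) := \{c_2\mathbf{i_1}+c_3\mathbf{i_2}+c_6\mathbf{j_2}: c_2,c_3,c_6\in\mathbb{R},\ c_2\mathbf{i_1}+c_3\mathbf{i_2}-c_6\mathbf{j_1} \in \mathcal{T}(\mathbf{i_1},\mathbf{i_2},\mathbf{j_1})\}.$$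
   Context: The tricomplex numbers $\mathbb{TC}$ form the commutative, associative unital real algebra generated by three commuting elements $\mathbf{i_1},\mathbf{i_2},\mathbf{i_3}$ with $\mathbf{i_1}^2=\mathbf{i_2}^2=\mathbf{i_3}^2=-1$; it has dimension 8 over $\mathbb{R}$ with basis $1,\mathbf{i_1},\mathbf{i_2},\mathbf{j_1},\mathbf{i_3},\mathbf{j_2},\mathbf{j_3},\mathbf{i_4}$, where $\mathbf{j_1}=\mathbf{i_1}\mathbf{i_2}$, $\mathbf{j_2}=\mathbf{i_1}\mathbf{i_3}$, $\mathbf{j_3}=\mathbf{i_2}\mathbf{i_3}$ and $\mathbf{i_4}=\mathbf{i_1}\mathbf{i_2}\mathbf{i_3}$. Boundedness in $\mathbb{TC}\cong\mathbb{R}^8$ is with respect to the Euclidean norm. For $c\in\mathbb{TC}$ let $P_c(\eta)=\eta^2+c$ and let $P_c^{(n)}$ be its $n$-fold composition. The tricomplex Mandelbrot set is $\mathcal{M}_3=\{c\in\mathbb{TC}:\{P_c^{(n)}(0)\}_{n\in\mathbb{N}}\text{ is bounded}\}$. For three distinct units $\mathbf{u},\mathbf{v},\mathbf{w}\in\{1,\mathbf{i_1},\mathbf{i_2},\mathbf{j_1},\mathbf{i_3},\mathbf{j_2},\mathbf{j_3},\mathbf{i_4}\}$, the principal 3D slice is $\mathcal{T}(\mathbf{u},\mathbf{v},\mathbf{w})=\mathrm{span}_{\mathbb{R}}\{\mathbf{u},\mathbf{v},\mathbf{w}\}\cap\mathcal{M}_3$. *)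

theory Defs
  imports "HOL-Analysis.Analysis"
begin

text \<open>
  The eight fields are the real coordinates with respect to the ordered basis
  1, i1, i2, j1, i3, j2, j3, i4.
\<close>
codatatype tricomplex = Tricomplex
  (tc1: real)
  (tc2: real)
  (tc3: real)
  (tc4: real)
  (tc5: real)
  (tc6: real)
  (tc7: real)
  (tc8: real)

lemma tricomplex_eqI:
  "\<lbrakk>tc1 x = tc1 y;
    tc2 x = tc2 y;
    tc3 x = tc3 y;
    tc4 x = tc4 y;
    tc5 x = tc5 y;
    tc6 x = tc6 y;
    tc7 x = tc7 y;
    tc8 x = tc8 y\<rbrakk> \<Longrightarrow> x = y"
  by (rule tricomplex.expand) simp

lemma tricomplex_eq_iff:
  "x = y \<longleftrightarrow> tc1 x = tc1 y \<and>
    tc2 x = tc2 y \<and>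
    tc3 x = tc3 y \<and>
    tc4 x = tc4 y \<and>
    tc5 x = tc5 y \<and>
    tc6 x = tc6 y \<and>
    tc7 x = tc7 y \<and>
    tc8 x = tc8 y"
  by (auto intro: tricomplex_eqI)

instantiation tricomplex :: ab_group_add
begin

primcorec zero_tricomplex :: "tricomplex" where
  "tc1 (0) = 0"
| "tc2 (0) = 0"
| "tc3 (0) = 0"
| "tc4 (0) = 0"
| "tc5 (0) = 0"
| "tc6 (0) = 0"
| "tc7 (0) = 0"
| "tc8 (0) = 0"

primcorec plus_tricomplex :: "tricomplex \<Rightarrow> tricomplex \<Rightarrow> tricomplex" where
  "tc1 (x + y) = tc1 x + tc1 y"
| "tc2 (x + y) = tc2 x + tc2 y"
| "tc3 (x + y) = tc3 x + tc3 y"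
| "tc4 (x + y) = tc4 x + tc4 y"
| "tc5 (x + y) = tc5 x + tc5 y"
| "tc6 (x + y) = tc6 x + tc6 y"
| "tc7 (x + y) = tc7 x + tc7 y"
| "tc8 (x + y) = tc8 x + tc8 y"

primcorec uminus_tricomplex :: "tricomplex \<Rightarrow> tricomplex" where
  "tc1 (- x) = - tc1 x"
| "tc2 (- x) = - tc2 x"
| "tc3 (- x) = - tc3 x"
| "tc4 (- x) = - tc4 x"
| "tc5 (- x) = - tc5 x"
| "tc6 (- x) = - tc6 x"
| "tc7 (- x) = - tc7 x"
| "tc8 (- x) = - tc8 x"

primcorec minus_tricomplex :: "tricomplex \<Rightarrow> tricomplex \<Rightarrow> tricomplex" where
  "tc1 (x - y) = tc1 x - tc1 y"
| "tc2 (x - y) = tc2 x - tc2 y"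
| "tc3 (x - y) = tc3 x - tc3 y"
| "tc4 (x - y) = tc4 x - tc4 y"
| "tc5 (x - y) = tc5 x - tc5 y"
| "tc6 (x - y) = tc6 x - tc6 y"
| "tc7 (x - y) = tc7 x - tc7 y"
| "tc8 (x - y) = tc8 x - tc8 y"

instance
  by standard (simp_all add: tricomplex_eq_iff)

end

text \<open>
  The basis element in position \<open>k\<close> is the product of those generators i1, i2, i3 whose binary
  digit (of weight 1, 2, 4 respectively) is set in \<open>k - 1\<close>. Multiplying two basis elements adds
  these digits modulo 2, and every generator occurring in both factors contributes a factor -1.
\<close>
instantiation tricomplex :: comm_ring_1
begin

primcorec one_tricomplex :: "tricomplex" where
  "tc1 (1) = 1"
| "tc2 (1) = 0"
| "tc3 (1) = 0"
| "tc4 (1) = 0"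
| "tc5 (1) = 0"
| "tc6 (1) = 0"
| "tc7 (1) = 0"
| "tc8 (1) = 0"

primcorec times_tricomplex :: "tricomplex \<Rightarrow> tricomplex \<Rightarrow> tricomplex" where
  "tc1 (x * y) =
    tc1 x * tc1 y - tc2 x * tc2 y - tc3 x * tc3 y + tc4 x * tc4 y
    - tc5 x * tc5 y + tc6 x * tc6 y + tc7 x * tc7 y - tc8 x * tc8 y"
| "tc2 (x * y) =
    tc1 x * tc2 y + tc2 x * tc1 y - tc3 x * tc4 y - tc4 x * tc3 y
    - tc5 x * tc6 y - tc6 x * tc5 y + tc7 x * tc8 y + tc8 x * tc7 y"
| "tc3 (x * y) =
    tc1 x * tc3 y - tc2 x * tc4 y + tc3 x * tc1 y - tc4 x * tc2 y
    - tc5 x * tc7 y + tc6 x * tc8 y - tc7 x * tc5 y + tc8 x * tc6 y"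
| "tc4 (x * y) =
    tc1 x * tc4 y + tc2 x * tc3 y + tc3 x * tc2 y + tc4 x * tc1 y
    - tc5 x * tc8 y - tc6 x * tc7 y - tc7 x * tc6 y - tc8 x * tc5 y"
| "tc5 (x * y) =
    tc1 x * tc5 y - tc2 x * tc6 y - tc3 x * tc7 y + tc4 x * tc8 y
    + tc5 x * tc1 y - tc6 x * tc2 y - tc7 x * tc3 y + tc8 x * tc4 y"
| "tc6 (x * y) =
    tc1 x * tc6 y + tc2 x * tc5 y - tc3 x * tc8 y - tc4 x * tc7 y
    + tc5 x * tc2 y + tc6 x * tc1 y - tc7 x * tc4 y - tc8 x * tc3 y"
| "tc7 (x * y) =
    tc1 x * tc7 y - tc2 x * tc8 y + tc3 x * tc5 y - tc4 x * tc6 y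
    + tc5 x * tc3 y - tc6 x * tc4 y + tc7 x * tc1 y - tc8 x * tc2 y"
| "tc8 (x * y) =
    tc1 x * tc8 y + tc2 x * tc7 y + tc3 x * tc6 y + tc4 x * tc5 y
    + tc5 x * tc4 y + tc6 x * tc3 y + tc7 x * tc2 y + tc8 x * tc1 y"

instance
proof
  fix x y z :: tricomplex
  show "x * y * z = x * (y * z)"
    by (rule tricomplex_eqI) (simp_all add: algebra_simps)
qed (simp_all add: tricomplex_eq_iff algebra_simps)

end

instantiation tricomplex :: real_algebra_1
begin

primcorec scaleR_tricomplex :: "real \<Rightarrow> tricomplex \<Rightarrow> tricomplex" where
  "tc1 (r *\<^sub>R x) = r * tc1 x"
| "tc2 (r *\<^sub>R x) = r * tc2 x"
| "tc3 (r *\<^sub>R x) = r * tc3 x"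
| "tc4 (r *\<^sub>R x) = r * tc4 x"
| "tc5 (r *\<^sub>R x) = r * tc5 x"
| "tc6 (r *\<^sub>R x) = r * tc6 x"
| "tc7 (r *\<^sub>R x) = r * tc7 x"
| "tc8 (r *\<^sub>R x) = r * tc8 x"

instance
  by standard (simp_all add: tricomplex_eq_iff algebra_simps)

end

definition i1 :: tricomplex where
  "i1 = Tricomplex 0 1 0 0 0 0 0 0"

definition i2 :: tricomplex where
  "i2 = Tricomplex 0 0 1 0 0 0 0 0"

definition i3 :: tricomplex where
  "i3 = Tricomplex 0 0 0 0 1 0 0 0"

definition j1 :: tricomplex where
  "j1 = i1 * i2"

definition j2 :: tricomplex where
  "j2 = i1 * i3"

definition j3 :: tricomplex where
  "j3 = i2 * i3"

definition i4 :: tricomplex where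
  "i4 = i1 * i2 * i3"

definition tc_units :: "tricomplex set" where
  "tc_units = {1, i1, i2, j1, i3, j2, j3, i4}"

lemma tc_units_coords [simp]:
  "tc1 i1 = 0" "tc2 i1 = 1" "tc3 i1 = 0" "tc4 i1 = 0" "tc5 i1 = 0" "tc6 i1 = 0" "tc7 i1 = 0" "tc8 i1 = 0"
  "tc1 i2 = 0" "tc2 i2 = 0" "tc3 i2 = 1" "tc4 i2 = 0" "tc5 i2 = 0" "tc6 i2 = 0" "tc7 i2 = 0" "tc8 i2 = 0"
  "tc1 j1 = 0" "tc2 j1 = 0" "tc3 j1 = 0" "tc4 j1 = 1" "tc5 j1 = 0" "tc6 j1 = 0" "tc7 j1 = 0" "tc8 j1 = 0"
  "tc1 i3 = 0" "tc2 i3 = 0" "tc3 i3 = 0" "tc4 i3 = 0" "tc5 i3 = 1" "tc6 i3 = 0" "tc7 i3 = 0" "tc8 i3 = 0"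
  "tc1 j2 = 0" "tc2 j2 = 0" "tc3 j2 = 0" "tc4 j2 = 0" "tc5 j2 = 0" "tc6 j2 = 1" "tc7 j2 = 0" "tc8 j2 = 0"
  "tc1 j3 = 0" "tc2 j3 = 0" "tc3 j3 = 0" "tc4 j3 = 0" "tc5 j3 = 0" "tc6 j3 = 0" "tc7 j3 = 1" "tc8 j3 = 0"
  "tc1 i4 = 0" "tc2 i4 = 0" "tc3 i4 = 0" "tc4 i4 = 0" "tc5 i4 = 0" "tc6 i4 = 0" "tc7 i4 = 0" "tc8 i4 = 1"
  by (simp_all add: i1_def i2_def i3_def j1_def j2_def j3_def i4_def)

lemma generator_squares: "i1\<^sup>2 = - 1" "i2\<^sup>2 = - 1" "i3\<^sup>2 = - 1"
  by (simp_all add: power2_eq_square tricomplex_eq_iff)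

instantiation tricomplex :: real_inner
begin

definition inner_tricomplex :: "tricomplex \<Rightarrow> tricomplex \<Rightarrow> real" where
  "x \<bullet> y = tc1 x * tc1 y + tc2 x * tc2 y + tc3 x * tc3 y + tc4 x * tc4 y +
    tc5 x * tc5 y + tc6 x * tc6 y + tc7 x * tc7 y + tc8 x * tc8 y"

definition norm_tricomplex :: "tricomplex \<Rightarrow> real" where
  "norm x = sqrt ((tc1 x)\<^sup>2 + (tc2 x)\<^sup>2 + (tc3 x)\<^sup>2 + (tc4 x)\<^sup>2 +
    (tc5 x)\<^sup>2 + (tc6 x)\<^sup>2 + (tc7 x)\<^sup>2 + (tc8 x)\<^sup>2)"

definition sgn_tricomplex :: "tricomplex \<Rightarrow> tricomplex" where
  "sgn (x :: tricomplex) = x /\<^sub>R norm x"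

definition dist_tricomplex :: "tricomplex \<Rightarrow> tricomplex \<Rightarrow> real" where
  "dist (x :: tricomplex) y = norm (x - y)"

definition [code del]:
  "(uniformity :: (tricomplex \<times> tricomplex) filter) = (INF e\<in>{0 <..}. principal {(x, y). dist x y < e})"

definition [code del]:
  "open (U :: tricomplex set) \<longleftrightarrow> (\<forall>x\<in>U. eventually (\<lambda>(x', y). x' = x \<longrightarrow> y \<in> U) uniformity)"

instance
proof
  fix x y z :: tricomplex and r :: real
  show "dist x y = norm (x - y)"
    by (rule dist_tricomplex_def)
  show "sgn (x :: tricomplex) = x /\<^sub>R norm x"
    by (rule sgn_tricomplex_def)
  show "uniformity = (INF e\<in>{0 <..}. principal {(x :: tricomplex, y). dist x y < e})"
    by (rule uniformity_tricomplex_def)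
  show "open U \<longleftrightarrow> (\<forall>x\<in>U. eventually (\<lambda>(x', y). x' = x \<longrightarrow> y \<in> U) uniformity)"
    for U :: "tricomplex set"
    by (rule open_tricomplex_def)
  show "x \<bullet> y = y \<bullet> x"
    by (simp add: inner_tricomplex_def mult.commute)
  show "(x + y) \<bullet> z = x \<bullet> z + y \<bullet> z"
    by (simp add: inner_tricomplex_def algebra_simps)
  show "(r *\<^sub>R x) \<bullet> y = r * (x \<bullet> y)"
    by (simp add: inner_tricomplex_def algebra_simps)
  show "0 \<le> x \<bullet> x"
    by (simp add: inner_tricomplex_def)
  show "x \<bullet> x = 0 \<longleftrightarrow> x = 0"
    by (simp add: inner_tricomplex_def tricomplex_eq_iff add_nonneg_eq_0_iff)
  show "norm x = sqrt (x \<bullet> x)"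
    by (simp add: norm_tricomplex_def inner_tricomplex_def power2_eq_square)
qed

end

instantiation tricomplex :: euclidean_space
begin

definition Basis_tricomplex :: "tricomplex set" where
  "Basis = tc_units"

instance
proof
  fix u v x :: tricomplex
  show "(Basis :: tricomplex set) \<noteq> {}" "finite (Basis :: tricomplex set)"
    by (simp_all add: Basis_tricomplex_def tc_units_def)
  show "u \<bullet> v = (if u = v then 1 else 0)" if "u \<in> Basis" "v \<in> Basis"
    using that unfolding Basis_tricomplex_def tc_units_def
    by (elim insertE emptyE) (simp_all add: inner_tricomplex_def tricomplex_eq_iff)
  show "(\<forall>u\<in>Basis. x \<bullet> u = 0) \<longleftrightarrow> x = 0"
    unfolding Basis_tricomplex_def tc_units_def
    by (simp add: inner_tricomplex_def) (auto simp: tricomplex_eq_iff)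
qed

end

lemma DIM_tricomplex: "DIM(tricomplex) = 8"
  by (simp add: Basis_tricomplex_def tc_units_def tricomplex_eq_iff)

definition quad_map :: "tricomplex \<Rightarrow> tricomplex \<Rightarrow> tricomplex" where
  "quad_map c \<eta> = \<eta>\<^sup>2 + c"

definition Mandelbrot3 :: "tricomplex set" where
  "Mandelbrot3 = {c. bounded (range (\<lambda>n. (quad_map c ^^ n) 0))}"

text \<open>Only used for three distinct units.\<close>
definition slice3 :: "tricomplex \<Rightarrow> tricomplex \<Rightarrow> tricomplex \<Rightarrow> tricomplex set" where
  "slice3 u v w = span {u, v, w} \<inter> Mandelbrot3"

text \<open>The defining condition uses \<open>j1\<close>, while the elements of the sets are combinations with \<open>j2\<close>.\<close>
definition slice3_star_j1 :: "tricomplex set" where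
  "slice3_star_j1 =
    {c2 *\<^sub>R i1 + c3 *\<^sub>R i2 + c6 *\<^sub>R j2 | c2 c3 c6 :: real.
      c2 *\<^sub>R i1 + c3 *\<^sub>R i2 + c6 *\<^sub>R j1 \<in> slice3 i1 i2 j1}"

definition slice3_star_minus_j1 :: "tricomplex set" where
  "slice3_star_minus_j1 =
    {c2 *\<^sub>R i1 + c3 *\<^sub>R i2 + c6 *\<^sub>R j2 | c2 c3 c6 :: real.
      c2 *\<^sub>R i1 + c3 *\<^sub>R i2 - c6 *\<^sub>R j1 \<in> slice3 i1 i2 j1}"

end

theory Submission imports Defs begin

text \<open>
  Since \<open>i2\<close> and \<open>i3\<close> are both square roots of \<open>-1\<close>, the product \<open>j3 = i2 * i3\<close> squares to \<open>1\<close>, so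
  \<open>(1 + j3) / 2\<close> and \<open>(1 - j3) / 2\<close> are complementary idempotents and the tricomplex algebra splits
  as a product of two copies of the bicomplex algebra spanned by \<open>1, i1, i2, j1\<close>. On the first
  factor \<open>j3\<close> acts as \<open>1\<close>, which forces \<open>i3 = -i2\<close>; on the second it acts as \<open>-1\<close>, which forces
  \<open>i3 = i2\<close>. The two projections are therefore the algebra homomorphisms that substitute \<open>-i2\<close>
  or \<open>i2\<close> for \<open>i3\<close> and fix \<open>i1\<close> and \<open>i2\<close>.

  A homomorphism carries the orbit of \<open>0\<close> under \<open>\<eta>\<^sup>2 + c\<close> to the orbit of \<open>0\<close> for the image of
  \<open>c\<close>, and an orbit is bounded precisely when both of its projections are. Hence \<open>c\<close> lies in the
  tricomplex Mandelbrot set iff both projections of \<open>c\<close> do (\<open>Mandelbrot3_iff_subst_i3\<close>). For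
  \<open>c = c2 i1 + c3 i2 + c6 j2\<close>, where \<open>j2 = i1 * i3\<close>, the projections are
  \<open>c2 i1 + c3 i2 - c6 j1\<close> and \<open>c2 i1 + c3 i2 + c6 j1\<close>, which yields the two sets of the theorem.
\<close>

text \<open>
  Substitution of \<open>s i2\<close> for \<open>i3\<close>: it sends \<open>i3, j2, j3, i4\<close> to \<open>s i2, s j1, -s, -s i1\<close>. It is
  an algebra homomorphism exactly for \<open>s = 1\<close> and \<open>s = -1\<close>.
\<close>
definition subst_i3 :: "real \<Rightarrow> tricomplex \<Rightarrow> tricomplex" where
  "subst_i3 s x =
    Tricomplex (tc1 x - s * tc7 x) (tc2 x - s * tc8 x) (tc3 x + s * tc5 x) (tc4 x + s * tc6 x)
      0 0 0 0"

lemma subst_i3_zero: "subst_i3 s 0 = 0"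
  by (simp add: subst_i3_def tricomplex_eq_iff)

lemma subst_i3_add: "subst_i3 s (x + y) = subst_i3 s x + subst_i3 s y"
  by (simp add: subst_i3_def tricomplex_eq_iff algebra_simps)

lemma subst_i3_scaleR: "subst_i3 s (r *\<^sub>R x) = r *\<^sub>R subst_i3 s x"
  by (simp add: subst_i3_def tricomplex_eq_iff algebra_simps)

lemma bounded_linear_subst_i3: "bounded_linear (subst_i3 s)"
  by (intro linear_conv_bounded_linear[THEN iffD1] linearI subst_i3_add subst_i3_scaleR)

lemma subst_i3_mult:
  assumes "s = 1 \<or> s = - 1"
  shows "subst_i3 s (x * y) = subst_i3 s x * subst_i3 s y"
  using assms
  by (elim disjE) (simp_all add: subst_i3_def tricomplex_eq_iff algebra_simps)

lemma subst_i3_orbit: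
  assumes "s = 1 \<or> s = - 1"
  shows "subst_i3 s ((quad_map c ^^ n) 0) = (quad_map (subst_i3 s c) ^^ n) 0"
  by (induction n)
    (simp_all add: subst_i3_zero quad_map_def power2_eq_square subst_i3_add subst_i3_mult[OF assms])

text \<open>
  The signs are crossed because \<open>i3 = s i2\<close> gives \<open>j3 = -s\<close>, so the component in which \<open>i3\<close>
  becomes \<open>-i2\<close> is the one cut out by \<open>(1 + j3) / 2\<close>.
\<close>
lemma idempotent_decomposition:
  "x = (1/2) *\<^sub>R (1 + j3) * subst_i3 (- 1) x + (1/2) *\<^sub>R (1 - j3) * subst_i3 1 x"
  by (simp add: subst_i3_def tricomplex_eq_iff field_simps)

lemma bounded_linear_mult_left_tricomplex: "bounded_linear (\<lambda>x :: tricomplex. a * x)"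
  by (intro linear_conv_bounded_linear[THEN iffD1] linearI) (simp_all add: distrib_left)

lemma bounded_range_iff_subst_i3:
  "bounded (range f) \<longleftrightarrow>
    bounded (range (\<lambda>n. subst_i3 (- 1) (f n))) \<and> bounded (range (\<lambda>n. subst_i3 1 (f n)))"
proof (intro iffI conjI; (elim conjE)?)
  assume f: "bounded (range f)"
  have "bounded (range (\<lambda>n. subst_i3 s (f n)))" for s
    using bounded_linear_image[OF f bounded_linear_subst_i3] by (simp add: image_image)
  then show "bounded (range (\<lambda>n. subst_i3 (- 1) (f n)))" "bounded (range (\<lambda>n. subst_i3 1 (f n)))"
    by blast+
next
  assume *: "bounded (range (\<lambda>n. subst_i3 (- 1) (f n)))" "bounded (range (\<lambda>n. subst_i3 1 (f n)))"
  have "bounded (range (\<lambda>n. a * subst_i3 s (f n)))"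
    if "bounded (range (\<lambda>n. subst_i3 s (f n)))" for a s
    using bounded_linear_image[OF that bounded_linear_mult_left_tricomplex]
    by (simp add: image_image)
  then have "bounded (range (\<lambda>n. (1/2) *\<^sub>R (1 + j3) * subst_i3 (- 1) (f n)
      + (1/2) *\<^sub>R (1 - j3) * subst_i3 1 (f n)))"
    using * by (intro bounded_plus_comp) blast+
  then show "bounded (range f)"
    by (subst (asm) idempotent_decomposition[symmetric])
qed

lemma Mandelbrot3_iff_subst_i3:
  "c \<in> Mandelbrot3 \<longleftrightarrow> subst_i3 (- 1) c \<in> Mandelbrot3 \<and> subst_i3 1 c \<in> Mandelbrot3"
  unfolding Mandelbrot3_def mem_Collect_eq
  by (subst bounded_range_iff_subst_i3) (simp add: subst_i3_orbit)

lemma Mandelbrot3_i1_i2_j2_iff: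
  "c2 *\<^sub>R i1 + c3 *\<^sub>R i2 + c6 *\<^sub>R j2 \<in> Mandelbrot3 \<longleftrightarrow>
    c2 *\<^sub>R i1 + c3 *\<^sub>R i2 - c6 *\<^sub>R j1 \<in> Mandelbrot3 \<and>
    c2 *\<^sub>R i1 + c3 *\<^sub>R i2 + c6 *\<^sub>R j1 \<in> Mandelbrot3"
proof -
  have "subst_i3 (- 1) (c2 *\<^sub>R i1 + c3 *\<^sub>R i2 + c6 *\<^sub>R j2) = c2 *\<^sub>R i1 + c3 *\<^sub>R i2 - c6 *\<^sub>R j1"
    and "subst_i3 1 (c2 *\<^sub>R i1 + c3 *\<^sub>R i2 + c6 *\<^sub>R j2) = c2 *\<^sub>R i1 + c3 *\<^sub>R i2 + c6 *\<^sub>R j1"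
    by (simp_all add: subst_i3_def tricomplex_eq_iff)
  then show ?thesis
    by (subst Mandelbrot3_iff_subst_i3) simp
qed

lemma span_3_eq:
  fixes u v w :: "'a :: real_vector"
  shows "span {u, v, w} = {a *\<^sub>R u + b *\<^sub>R v + c *\<^sub>R w | a b c. True}"
  by (auto simp: span_insert algebra_simps)

lemma i1_i2_j2_coords_unique:
  "a *\<^sub>R i1 + b *\<^sub>R i2 + c *\<^sub>R j2 = a' *\<^sub>R i1 + b' *\<^sub>R i2 + c' *\<^sub>R j2 \<longleftrightarrow> a = a' \<and> b = b' \<and> c = c'"
  by (auto simp: tricomplex_eq_iff)

theorem proposition7:
  "slice3 i1 i2 j2 = slice3_star_minus_j1 \<inter> slice3_star_j1"
proof -
  have span_plus: "c2 *\<^sub>R i1 + c3 *\<^sub>R i2 + c6 *\<^sub>R j1 \<in> span {i1, i2, j1}" for c2 c3 c6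
    unfolding span_3_eq by blast
  have span_minus: "c2 *\<^sub>R i1 + c3 *\<^sub>R i2 - c6 *\<^sub>R j1 \<in> span {i1, i2, j1}" for c2 c3 c6
    using span_plus[of c2 c3 "- c6"] by simp
  have "slice3_star_minus_j1 \<inter> slice3_star_j1 =
    {c2 *\<^sub>R i1 + c3 *\<^sub>R i2 + c6 *\<^sub>R j2 | c2 c3 c6.
      c2 *\<^sub>R i1 + c3 *\<^sub>R i2 - c6 *\<^sub>R j1 \<in> Mandelbrot3 \<and>
      c2 *\<^sub>R i1 + c3 *\<^sub>R i2 + c6 *\<^sub>R j1 \<in> Mandelbrot3}"
    \<comment> \<open>A common element has a single triple of coordinates, so both conditions bear on it.\<close>
    unfolding slice3_star_minus_j1_def slice3_star_j1_def slice3_def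
    using span_plus span_minus by (fastforce simp: i1_i2_j2_coords_unique)
  also have "\<dots> = slice3 i1 i2 j2"
    unfolding slice3_def span_3_eq by (fastforce simp: Mandelbrot3_i1_i2_j2_iff)
  finally show ?thesis by (rule sym)
qed

end
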